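(* Let $L$ be a frame. Arbitrary meets in the complete lattice $\mathrm{Nuc}(L)$ are calculated pointwise, same as they are calculated in the complete lattice $\mathrm{Cl}(L)$. As arbitrary joins in $\mathrm{Nuc}(L)$ also are calculated in $\mathrm{Cl}(L)$, the complete lattice $\mathrm{Nuc}(L)$ is a sub-(complete lattice) of the complete lattice $\mathrm{Cl}(L)$, i.e. the subset $\mathrm{Nuc}(L)$ of $\mathrm{Cl}(L)$ is closed under arbitrary joins and arbitrary meets taken in $\mathrm{Cl}(L)$.
   Context: A frame is a complete lattice in which $x\wedge\bigvee Y=\bigvee_{y\in Y}(x\wedge y)$ for every element $x$ and every subset $Y$. A closure operator on $L$ is a map $L\to L$ that is increasing, ascending ($x\le\gamma(x)$ for all $x$) and idempotent. A nucleus is a closure operator that preserves binary meets. $\mathrm{Cl}(L)$ and $\mathrm{Nuc}(L)$ are the sets of all closure operators, respectively all nuclei, on $L$, both ordered pointwise; both are complete lattices. Meets in $\mathrm{Cl}(L)$ are calculated pointwise. *)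

theory Defs
  imports "HOL-Algebra.Complete_Lattice"
begin

locale frame = complete_lattice +
  assumes meet_sup_distrib:
    "\<lbrakk>x \<in> carrier L; Y \<subseteq> carrier L\<rbrakk> \<Longrightarrow> x \<sqinter> \<Squnion>Y = \<Squnion>((\<lambda>y. x \<sqinter> y) ` Y)"

text \<open>
  Maps \<open>L \<rightarrow> L\<close> are taken extensional on the carrier, so that two of them are equal
  as HOL functions exactly when they agree on the elements of \<open>L\<close>; the pointwise order is then
  antisymmetric with respect to HOL equality.
\<close>

definition closure_operator :: "('a, 'b) gorder_scheme \<Rightarrow> ('a \<Rightarrow> 'a) \<Rightarrow> bool" where
  "closure_operator L \<gamma> \<longleftrightarrow>
     \<gamma> \<in> carrier L \<rightarrow>\<^sub>E carrier L \<and>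
     isotone L L \<gamma> \<and>
     (\<forall>x \<in> carrier L. x \<sqsubseteq>\<^bsub>L\<^esub> \<gamma> x) \<and>
     idempotent L \<gamma>"

definition nucleus :: "('a, 'b) gorder_scheme \<Rightarrow> ('a \<Rightarrow> 'a) \<Rightarrow> bool" where
  "nucleus L \<gamma> \<longleftrightarrow> closure_operator L \<gamma> \<and> meet_pres L L \<gamma>"

definition pointwise_order ::
    "('a, 'b) gorder_scheme \<Rightarrow> ('a \<Rightarrow> 'a) set \<Rightarrow> ('a \<Rightarrow> 'a) gorder" where
  "pointwise_order L F =
     \<lparr>carrier = F, eq = (=), le = (\<lambda>f g. \<forall>x \<in> carrier L. f x \<sqsubseteq>\<^bsub>L\<^esub> g x)\<rparr>"

definition Cl :: "('a, 'b) gorder_scheme \<Rightarrow> ('a \<Rightarrow> 'a) gorder" where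
  "Cl L = pointwise_order L {\<gamma>. closure_operator L \<gamma>}"

definition Nuc :: "('a, 'b) gorder_scheme \<Rightarrow> ('a \<Rightarrow> 'a) gorder" where
  "Nuc L = pointwise_order L {\<gamma>. nucleus L \<gamma>}"

definition pointwise_meet ::
    "('a, 'b) gorder_scheme \<Rightarrow> ('a \<Rightarrow> 'a) set \<Rightarrow> 'a \<Rightarrow> 'a" where
  "pointwise_meet L G = (\<lambda>x \<in> carrier L. \<Sqinter>\<^bsub>L\<^esub>((\<lambda>\<gamma>. \<gamma> x) ` G))"

text \<open>The family \<open>A\<close> below may be empty, so \<open>S\<close> has to contain the bottom and the top of \<open>M\<close>.\<close>

definition sub_complete_lattice :: "'a set \<Rightarrow> ('a, 'b) gorder_scheme \<Rightarrow> bool" where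
  "sub_complete_lattice S M \<longleftrightarrow>
     complete_lattice M \<and> S \<subseteq> carrier M \<and>
     (\<forall>A \<subseteq> S. \<Squnion>\<^bsub>M\<^esub>A \<in> S \<and> \<Sqinter>\<^bsub>M\<^esub>A \<in> S)"

end

theory Submission
  imports Defs
begin

text \<open>
  The only substantial point is that the join \<open>\<delta>\<close> in \<open>Cl(L)\<close> of a family of nuclei preserves binary
  meets. A closure operator is a nucleus as soon as its set of fixed points is closed under
  \<open>u \<mapsto> (a \<Rightarrow> u)\<close> for every \<open>a\<close>, where \<open>\<Rightarrow>\<close> is the Heyting implication of the frame: from
  \<open>x \<le> y \<Rightarrow> \<delta>(x \<and> y)\<close> one gets \<open>\<delta> x \<and> y \<le> \<delta>(x \<and> y)\<close>, and the same step in the other argument gives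
  \<open>\<delta> x \<and> \<delta> y \<le> \<delta>(x \<and> y)\<close>. Nuclei have this property, and the fixed points of \<open>\<delta>\<close> are the
  common fixed points of the family, so \<open>\<delta>\<close> has it as well.
\<close>

section \<open>The pointwise order on a set of maps\<close>

lemma pointwise_order_simps [simp]:
  "carrier (pointwise_order L F) = F"
  "eq (pointwise_order L F) = (=)"
  "f \<sqsubseteq>\<^bsub>pointwise_order L F\<^esub> g \<longleftrightarrow> (\<forall>x \<in> carrier L. f x \<sqsubseteq>\<^bsub>L\<^esub> g x)"
  by (simp_all add: pointwise_order_def)

context partial_order
begin

lemma partial_order_pointwise_order:
  assumes F: "F \<subseteq> carrier L \<rightarrow>\<^sub>E carrier L"
  shows "partial_order (pointwise_order L F)"
proof
  fix f g
  assume le: "f \<sqsubseteq>\<^bsub>pointwise_order L F\<^esub> g" "g \<sqsubseteq>\<^bsub>pointwise_order L F\<^esub> f"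
    and "f \<in> carrier (pointwise_order L F)" "g \<in> carrier (pointwise_order L F)"
  then have fg: "f \<in> carrier L \<rightarrow>\<^sub>E carrier L" "g \<in> carrier L \<rightarrow>\<^sub>E carrier L"
    using F by auto
  have "f = g"
    using fg
  proof (rule PiE_ext)
    show "f x = g x" if "x \<in> carrier L" for x
      using that le fg by (intro le_antisym) auto
  qed
  then show "f .=\<^bsub>pointwise_order L F\<^esub> g"
    by simp
next
  fix f g h
  assume "f \<in> carrier (pointwise_order L F)" "g \<in> carrier (pointwise_order L F)"
    "h \<in> carrier (pointwise_order L F)"
    and le: "f \<sqsubseteq>\<^bsub>pointwise_order L F\<^esub> g" "g \<sqsubseteq>\<^bsub>pointwise_order L F\<^esub> h"
  then have "f \<in> carrier L \<rightarrow>\<^sub>E carrier L" "g \<in> carrier L \<rightarrow>\<^sub>E carrier L"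
    "h \<in> carrier L \<rightarrow>\<^sub>E carrier L"
    using F by auto
  with le show "f \<sqsubseteq>\<^bsub>pointwise_order L F\<^esub> h"
    by (auto intro: le_trans)
qed (use F in \<open>force+\<close>)

end

context complete_lattice
begin

lemma lattice_L: "lattice L" ..

text \<open>\<open>isotone\<close> also demands that \<open>L\<close> is a weak partial order, and
  \<open>idempotent\<close> is stated with the equivalence of \<open>L\<close>. Both are settled in
  a complete lattice, so plain conditions on elements remain.\<close>

lemma closure_operator_iff:
  "closure_operator L f \<longleftrightarrow>
     f \<in> carrier L \<rightarrow>\<^sub>E carrier L \<and>
     (\<forall>x \<in> carrier L. \<forall>y \<in> carrier L. x \<sqsubseteq> y \<longrightarrow> f x \<sqsubseteq> f y) \<and>
     (\<forall>x \<in> carrier L. x \<sqsubseteq> f x) \<and>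
     (\<forall>x \<in> carrier L. f (f x) = f x)"
  unfolding closure_operator_def isotone_def idempotent_def eq_is_equal
  using weak_partial_order_axioms by blast

lemma nucleus_iff:
  "nucleus L f \<longleftrightarrow> closure_operator L f \<and>
     (\<forall>x \<in> carrier L. \<forall>y \<in> carrier L. f (x \<sqinter> y) = f x \<sqinter> f y)"
  unfolding nucleus_def meet_pres_def using lattice_L by blast

section \<open>Pointwise meets as infima in a set of maps\<close>

lemma pointwise_meet_apply:
  "x \<in> carrier L \<Longrightarrow> pointwise_meet L G x = \<Sqinter>((\<lambda>f. f x) ` G)"
  by (simp add: pointwise_meet_def)

lemma pointwise_meet_PiE:
  assumes "G \<subseteq> carrier L \<rightarrow>\<^sub>E carrier L"
  shows "pointwise_meet L G \<in> carrier L \<rightarrow>\<^sub>E carrier L"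
proof -
  have "(\<lambda>f. f x) ` G \<subseteq> carrier L" if "x \<in> carrier L" for x
    using assms that by auto
  then show ?thesis
    by (simp add: pointwise_meet_def)
qed

lemma pointwise_meet_lower:
  assumes "G \<subseteq> carrier L \<rightarrow>\<^sub>E carrier L" "f \<in> G" "x \<in> carrier L"
  shows "pointwise_meet L G x \<sqsubseteq> f x"
  unfolding pointwise_meet_apply[OF assms(3)] by (rule inf_lower) (use assms in auto)

lemma pointwise_meet_greatest:
  assumes "G \<subseteq> carrier L \<rightarrow>\<^sub>E carrier L" "x \<in> carrier L" "z \<in> carrier L"
    and "\<And>f. f \<in> G \<Longrightarrow> z \<sqsubseteq> f x"
  shows "z \<sqsubseteq> pointwise_meet L G x"
  unfolding pointwise_meet_apply[OF assms(2)] by (rule inf_greatest) (use assms in auto)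

lemma pointwise_meet_is_greatest:
  assumes F: "F \<subseteq> carrier L \<rightarrow>\<^sub>E carrier L"
    and G: "G \<subseteq> F" and closed: "pointwise_meet L G \<in> F"
  shows "greatest (pointwise_order L F) (pointwise_meet L G) (Lower (pointwise_order L F) G)"
proof (rule greatest_LowerI)
  fix g assume g: "g \<in> Lower (pointwise_order L F) G"
  then have "g \<in> carrier L \<rightarrow>\<^sub>E carrier L"
    using F by (auto simp: Lower_def)
  with g F G show "g \<sqsubseteq>\<^bsub>pointwise_order L F\<^esub> pointwise_meet L G"
    by (auto simp: Lower_def intro!: pointwise_meet_greatest)
qed (use assms in \<open>auto intro!: pointwise_meet_lower\<close>)

text \<open>A partial order with all meets is a complete lattice, as joins are meets of sets of
  upper bounds. Hence closure under pointwise meets is all that has to be checked for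
  \<open>Cl L\<close> and \<open>Nuc L\<close>.\<close>

lemma complete_lattice_pointwise_order:
  assumes F: "F \<subseteq> carrier L \<rightarrow>\<^sub>E carrier L"
    and closed: "\<And>G. G \<subseteq> F \<Longrightarrow> pointwise_meet L G \<in> F"
  shows "complete_lattice (pointwise_order L F)"
proof -
  interpret P: partial_order "pointwise_order L F"
    using F by (rule partial_order_pointwise_order)
  have inf: "\<exists>i. greatest (pointwise_order L F) i (Lower (pointwise_order L F) G)"
    if "G \<subseteq> F" for G
    using pointwise_meet_is_greatest[OF F that closed[OF that]] by blast
  interpret W: weak_complete_lattice "pointwise_order L F"
    \<comment> \<open>Every element is a lower bound of the empty family, so its meet is the top
      element that the criterion asks for separately.\<close>
    using inf[of "{}"] inf by (intro P.weak_complete_lattice_criterion1) auto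
  show ?thesis
    by unfold_locales (use W.sup_exists W.inf_exists in auto)
qed

text \<open>The infimum is a Hilbert choice among greatest lower bounds; antisymmetry leaves only
  one candidate.\<close>

lemma inf_pointwise_order:
  assumes F: "F \<subseteq> carrier L \<rightarrow>\<^sub>E carrier L"
    and G: "G \<subseteq> F" and closed: "pointwise_meet L G \<in> F"
  shows "\<Sqinter>\<^bsub>pointwise_order L F\<^esub>G = pointwise_meet L G"
proof -
  interpret P: partial_order "pointwise_order L F"
    using F by (rule partial_order_pointwise_order)
  note greatest = pointwise_meet_is_greatest[OF F G closed]
  show ?thesis
    unfolding inf_def by (rule some_equality[of _ "pointwise_meet L G"])
      (use greatest P.greatest_unique in blast)+
qed

section \<open>Pointwise meets of closure operators and of nuclei\<close>

lemma closure_operator_pointwise_meet: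
  assumes "\<And>f. f \<in> G \<Longrightarrow> closure_operator L f"
  shows "closure_operator L (pointwise_meet L G)"
proof -
  let ?m = "pointwise_meet L G"
  have G: "G \<subseteq> carrier L \<rightarrow>\<^sub>E carrier L"
    using assms unfolding closure_operator_iff by blast
  have m: "?m x \<in> carrier L" if "x \<in> carrier L" for x
    using pointwise_meet_PiE[OF G] that by auto
  have fc: "f x \<in> carrier L" if "f \<in> G" "x \<in> carrier L" for f x
    using G that by auto
  have mono: "?m x \<sqsubseteq> ?m y" if "x \<in> carrier L" "y \<in> carrier L" "x \<sqsubseteq> y" for x y
  proof (rule pointwise_meet_greatest[OF G])
    fix f assume f: "f \<in> G"
    have "?m x \<sqsubseteq> f x"
      using pointwise_meet_lower[OF G f] that by simp
    also have "f x \<sqsubseteq> f y"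
      using assms[OF f] that by (simp add: closure_operator_iff)
    finally show "?m x \<sqsubseteq> f y"
      using m fc f that by simp
  qed (use that m in auto)
  have ascending: "x \<sqsubseteq> ?m x" if "x \<in> carrier L" for x
    using that assms by (intro pointwise_meet_greatest[OF G]) (auto simp: closure_operator_iff)
  have "?m (?m x) \<sqsubseteq> ?m x" if x: "x \<in> carrier L" for x
  proof (rule pointwise_meet_greatest[OF G])
    fix f assume f: "f \<in> G"
    have mono_f: "f y \<sqsubseteq> f z" if "y \<in> carrier L" "z \<in> carrier L" "y \<sqsubseteq> z" for y z
      using assms[OF f] that by (simp add: closure_operator_iff)
    \<comment> \<open>Idempotence is checked against each member: \<open>?m (?m x)\<close> lies
      below \<open>f (?m x)\<close>, hence below \<open>f (f x) = f x\<close>.\<close>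
    have "?m (?m x) \<sqsubseteq> f (?m x)"
      using pointwise_meet_lower[OF G f] m x by simp
    also have "f (?m x) \<sqsubseteq> f (f x)"
      by (rule mono_f[OF m[OF x] fc[OF f x] pointwise_meet_lower[OF G f x]])
    also have "f (f x) = f x"
      using assms[OF f] x by (simp add: closure_operator_iff)
    finally show "?m (?m x) \<sqsubseteq> f x"
      using m fc f x by simp
  qed (use x m in auto)
  then have "?m (?m x) = ?m x" if "x \<in> carrier L" for x
    using that m ascending by (intro le_antisym) auto
  then show ?thesis
    using pointwise_meet_PiE[OF G] mono ascending by (simp add: closure_operator_iff)
qed

lemma closure_operator_meet_le:
  assumes "closure_operator L f" "x \<in> carrier L" "y \<in> carrier L"
  shows "f (x \<sqinter> y) \<sqsubseteq> f x \<sqinter> f y"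
  using assms by (intro meet_le) (auto simp: closure_operator_iff PiE_iff meet_left meet_right)

text \<open>The opposite inequality follows from monotonicity alone, so it holds for every closure
  operator.\<close>

lemma nucleusI:
  assumes f: "closure_operator L f"
    and le: "\<And>x y. \<lbrakk>x \<in> carrier L; y \<in> carrier L\<rbrakk> \<Longrightarrow> f x \<sqinter> f y \<sqsubseteq> f (x \<sqinter> y)"
  shows "nucleus L f"
proof -
  have "f x \<in> carrier L" if "x \<in> carrier L" for x
    using f that by (auto simp: closure_operator_iff)
  then show ?thesis
    using f le closure_operator_meet_le[OF f] by (auto simp: nucleus_iff intro!: le_antisym)
qed

lemma nucleus_pointwise_meet:
  assumes "\<And>f. f \<in> G \<Longrightarrow> nucleus L f"
  shows "nucleus L (pointwise_meet L G)"
proof (rule nucleusI)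
  let ?m = "pointwise_meet L G"
  have cl: "closure_operator L f" if "f \<in> G" for f
    using assms that by (simp add: nucleus_iff)
  then show "closure_operator L ?m"
    by (rule closure_operator_pointwise_meet)
  have G: "G \<subseteq> carrier L \<rightarrow>\<^sub>E carrier L"
    using cl unfolding closure_operator_iff by blast
  have m: "?m x \<in> carrier L" if "x \<in> carrier L" for x
    using pointwise_meet_PiE[OF G] that by auto
  fix x y assume xy: "x \<in> carrier L" "y \<in> carrier L"
  show "?m x \<sqinter> ?m y \<sqsubseteq> ?m (x \<sqinter> y)"
  proof (rule pointwise_meet_greatest[OF G])
    fix f assume f: "f \<in> G"
    then have fc: "f x \<in> carrier L" "f y \<in> carrier L"
      using G xy by auto
    have "?m x \<sqinter> ?m y \<sqsubseteq> f x"
      by (rule le_trans[of _ "?m x"])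
        (use m fc xy pointwise_meet_lower[OF G f] meet_left in auto)
    moreover have "?m x \<sqinter> ?m y \<sqsubseteq> f y"
      by (rule le_trans[of _ "?m y"])
        (use m fc xy pointwise_meet_lower[OF G f] meet_right in auto)
    ultimately have "?m x \<sqinter> ?m y \<sqsubseteq> f x \<sqinter> f y"
      using m fc xy by (intro meet_le) auto
    also have "f x \<sqinter> f y = f (x \<sqinter> y)"
      using assms[OF f] xy by (simp add: nucleus_iff)
    finally show "?m x \<sqinter> ?m y \<sqsubseteq> f (x \<sqinter> y)" .
  qed (use m xy in auto)
qed

section \<open>Completeness of \<open>Cl L\<close> and \<open>Nuc L\<close>, and their meets\<close>

lemma closure_operators_PiE: "{f. closure_operator L f} \<subseteq> carrier L \<rightarrow>\<^sub>E carrier L"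
  by (auto simp: closure_operator_iff)

lemma nuclei_PiE: "{f. nucleus L f} \<subseteq> carrier L \<rightarrow>\<^sub>E carrier L"
  by (auto simp: nucleus_iff closure_operator_iff)

lemma complete_lattice_Cl: "complete_lattice (Cl L)"
  unfolding Cl_def
  by (rule complete_lattice_pointwise_order[OF closure_operators_PiE])
    (use closure_operator_pointwise_meet in blast)

lemma complete_lattice_Nuc: "complete_lattice (Nuc L)"
  unfolding Nuc_def
  by (rule complete_lattice_pointwise_order[OF nuclei_PiE])
    (use nucleus_pointwise_meet in blast)

lemma inf_Cl:
  assumes "G \<subseteq> carrier (Cl L)"
  shows "\<Sqinter>\<^bsub>Cl L\<^esub>G = pointwise_meet L G"
  using assms unfolding Cl_def
  by (intro inf_pointwise_order closure_operators_PiE)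
    (auto intro: closure_operator_pointwise_meet)

lemma inf_Nuc:
  assumes "G \<subseteq> carrier (Nuc L)"
  shows "\<Sqinter>\<^bsub>Nuc L\<^esub>G = pointwise_meet L G"
  using assms unfolding Nuc_def
  by (intro inf_pointwise_order nuclei_PiE) (auto intro: nucleus_pointwise_meet)

section \<open>Closure operators from sets of elements, and fixed points of joins in
  \<open>Cl L\<close>\<close>

definition closure_map :: "'a set \<Rightarrow> 'a \<Rightarrow> 'a" where
  "closure_map S = (\<lambda>x \<in> carrier L. \<Sqinter>{u \<in> S. x \<sqsubseteq> u})"

lemma closure_map_closed:
  assumes "S \<subseteq> carrier L" "x \<in> carrier L"
  shows "closure_map S x \<in> carrier L"
  using assms by (auto simp: closure_map_def intro!: inf_closed)

lemma closure_map_le: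
  assumes "S \<subseteq> carrier L" "x \<in> carrier L" "u \<in> S" "x \<sqsubseteq> u"
  shows "closure_map S x \<sqsubseteq> u"
  using assms by (auto simp: closure_map_def intro!: inf_lower)

lemma closure_map_greatest:
  assumes "S \<subseteq> carrier L" "x \<in> carrier L" "z \<in> carrier L"
    and "\<And>u. \<lbrakk>u \<in> S; x \<sqsubseteq> u\<rbrakk> \<Longrightarrow> z \<sqsubseteq> u"
  shows "z \<sqsubseteq> closure_map S x"
  using assms by (auto simp: closure_map_def intro!: inf_greatest)

text \<open>Idempotence: any \<open>u\<close> in \<open>S\<close> above \<open>x\<close> is also
  above \<open>closure_map S x\<close>, so the meet that defines
  \<open>closure_map S (closure_map S x)\<close> ranges over the same elements of
  \<open>S\<close>.\<close>

lemma closure_operator_closure_map: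
  assumes S: "S \<subseteq> carrier L"
  shows "closure_operator L (closure_map S)"
proof -
  let ?c = "closure_map S"
  note c = closure_map_closed[OF S]
  have ascending: "x \<sqsubseteq> ?c x" if "x \<in> carrier L" for x
    using that by (intro closure_map_greatest[OF S])
  have mono: "?c x \<sqsubseteq> ?c y" if "x \<in> carrier L" "y \<in> carrier L" "x \<sqsubseteq> y" for x y
    using that S c by (intro closure_map_greatest[OF S] closure_map_le[OF S]) (auto intro: le_trans)
  have "?c (?c x) \<sqsubseteq> ?c x" if "x \<in> carrier L" for x
    using that by (intro closure_map_greatest[OF S] closure_map_le[OF S] c)
  then have "?c (?c x) = ?c x" if "x \<in> carrier L" for x
    using that c ascending by (intro le_antisym) auto
  moreover have "?c \<in> carrier L \<rightarrow>\<^sub>E carrier L"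
    using c by (auto simp: closure_map_def)
  ultimately show ?thesis
    using ascending mono by (simp add: closure_operator_iff)
qed

text \<open>Joins in \<open>Cl L\<close> are not pointwise, but their fixed points are easy to
  describe. A point fixed by the join is fixed by every smaller closure operator; for the converse
  the join is bounded above by a closure operator that fixes all common fixed points.\<close>

lemma sup_Cl_fixed_iff:
  assumes G: "G \<subseteq> carrier (Cl L)" and u: "u \<in> carrier L"
  shows "(\<Squnion>\<^bsub>Cl L\<^esub>G) u = u \<longleftrightarrow> (\<forall>f \<in> G. f u = u)"
proof -
  interpret C: complete_lattice "Cl L"
    by (rule complete_lattice_Cl)
  let ?d = "\<Squnion>\<^bsub>Cl L\<^esub>G"
  have cl: "closure_operator L f" if "f \<in> G" for f
    using G that by (auto simp: Cl_def)
  have d: "closure_operator L ?d"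
    using C.sup_closed[OF G] by (simp add: Cl_def)
  have fc: "f x \<in> carrier L" "x \<sqsubseteq> f x"
    if "closure_operator L f" "x \<in> carrier L" for f x
    using that by (auto simp: closure_operator_iff)
  show ?thesis
  proof
    assume fixed: "?d u = u"
    show "\<forall>f \<in> G. f u = u"
    proof
      fix f assume f: "f \<in> G"
      have "f u \<sqsubseteq> u"
        using C.sup_upper[OF G f] u fixed by (auto simp: Cl_def)
      then show "f u = u"
        using fc[OF cl[OF f] u] u by (intro le_antisym)
    qed
  next
    assume fixed: "\<forall>f \<in> G. f u = u"
    \<comment> \<open>\<open>closure_map S\<close> is the greatest closure operator fixing every
      element of \<open>S\<close>. All members of \<open>G\<close> fix these elements, so it is an
      upper bound of \<open>G\<close> and lies above the join.\<close>
    define S where "S = {v \<in> carrier L. \<forall>f \<in> G. f v = v}"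
    have S: "S \<subseteq> carrier L"
      by (auto simp: S_def)
    have "?d \<sqsubseteq>\<^bsub>Cl L\<^esub> closure_map S"
    proof (rule C.sup_least[OF G])
      show "closure_map S \<in> carrier (Cl L)"
        using closure_operator_closure_map[OF S] by (simp add: Cl_def)
      fix f assume f: "f \<in> G"
      have "f x \<sqsubseteq> closure_map S x" if x: "x \<in> carrier L" for x
      proof (rule closure_map_greatest[OF S x fc(1)[OF cl[OF f] x]])
        fix v assume "v \<in> S" "x \<sqsubseteq> v"
        then have "f x \<sqsubseteq> f v" "f v = v"
          using cl[OF f] x f by (auto simp: closure_operator_iff S_def)
        then show "f x \<sqsubseteq> v"
          by simp
      qed
      then show "f \<sqsubseteq>\<^bsub>Cl L\<^esub> closure_map S"
        by (simp add: Cl_def)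
    qed
    then have "?d u \<sqsubseteq> closure_map S u"
      using u by (simp add: Cl_def)
    also have "closure_map S u \<sqsubseteq> u"
      using fixed u by (intro closure_map_le[OF S]) (auto simp: S_def)
    finally have "?d u \<sqsubseteq> u"
      using fc[OF d u] closure_map_closed[OF S u] u by simp
    then show "?d u = u"
      using fc[OF d u] u by (intro le_antisym)
  qed
qed

section \<open>Heyting implication and its link with nuclei\<close>

definition heyting_imp :: "'a \<Rightarrow> 'a \<Rightarrow> 'a" where
  "heyting_imp a u = \<Squnion>{z \<in> carrier L. a \<sqinter> z \<sqsubseteq> u}"

lemma heyting_imp_closed: "heyting_imp a u \<in> carrier L"
  by (auto simp: heyting_imp_def intro!: sup_closed)

end

context frame
begin

text \<open>The adjunction that makes \<open>heyting_imp a u\<close> the relative pseudocomplement.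
  The frame law enters in the forward direction: it turns the meet of \<open>a\<close> with the
  defining join into a join of elements below \<open>u\<close>.\<close>

lemma le_heyting_imp_iff:
  assumes a: "a \<in> carrier L" and u: "u \<in> carrier L" and z: "z \<in> carrier L"
  shows "z \<sqsubseteq> heyting_imp a u \<longleftrightarrow> a \<sqinter> z \<sqsubseteq> u"
proof
  let ?Z = "{z \<in> carrier L. a \<sqinter> z \<sqsubseteq> u}"
  have Z: "?Z \<subseteq> carrier L"
    by auto
  assume le: "z \<sqsubseteq> heyting_imp a u"
  have "a \<sqinter> z \<sqsubseteq> a \<sqinter> heyting_imp a u"
    by (rule meet_le, rule meet_left[OF a z], rule le_trans[OF meet_right[OF a z] le])
      (use a z heyting_imp_closed in auto)
  also have "a \<sqinter> heyting_imp a u \<sqsubseteq> u"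
    unfolding heyting_imp_def meet_sup_distrib[OF a Z] by (rule sup_least) (use a u in auto)
  finally show "a \<sqinter> z \<sqsubseteq> u"
    using a z u heyting_imp_closed by simp
next
  assume "a \<sqinter> z \<sqsubseteq> u"
  with z show "z \<sqsubseteq> heyting_imp a u"
    unfolding heyting_imp_def by (intro sup_upper) auto
qed

text \<open>With \<open>w = heyting_imp a u\<close>, the chain \<open>a \<sqinter> f w \<sqsubseteq>
  f a \<sqinter> f w = f (a \<sqinter> w) \<sqsubseteq> f u = u\<close> gives
  \<open>f w \<sqsubseteq> w\<close> by adjunction.\<close>

lemma nucleus_heyting_imp_fixed:
  assumes f: "nucleus L f" and a: "a \<in> carrier L" and u: "u \<in> carrier L" "f u = u"
  shows "f (heyting_imp a u) = heyting_imp a u"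
proof -
  let ?w = "heyting_imp a u"
  note w = heyting_imp_closed[of a u]
  have cl: "closure_operator L f"
    using f by (simp add: nucleus_iff)
  then have fc: "f x \<in> carrier L" "x \<sqsubseteq> f x" if "x \<in> carrier L" for x
    using that by (auto simp: closure_operator_iff)
  have "a \<sqinter> f ?w \<sqsubseteq> f a \<sqinter> f ?w"
    by (rule meet_le, rule le_trans[OF meet_left fc(2)], use a w fc meet_right in auto)
  also have "f a \<sqinter> f ?w = f (a \<sqinter> ?w)"
    using f a w by (simp add: nucleus_iff)
  also have "f (a \<sqinter> ?w) \<sqsubseteq> f u"
    using cl a w u(1) le_heyting_imp_iff[OF a u(1) w] by (simp add: closure_operator_iff)
  finally have "a \<sqinter> f ?w \<sqsubseteq> u"
    using a w u fc by simp
  then have "f ?w \<sqsubseteq> ?w"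
    using le_heyting_imp_iff a u w fc by simp
  then show ?thesis
    using w fc by (intro le_antisym) auto
qed

lemma nucleus_if_heyting_imp_fixed:
  assumes f: "closure_operator L f"
    and heyting_imp_fixed:
      "\<And>a u. \<lbrakk>a \<in> carrier L; u \<in> carrier L; f u = u\<rbrakk> \<Longrightarrow> f (heyting_imp a u) = heyting_imp a u"
  shows "nucleus L f"
proof (rule nucleusI[OF f])
  have fc: "f x \<in> carrier L" "x \<sqsubseteq> f x" "f (f x) = f x" if "x \<in> carrier L" for x
    using f that by (auto simp: closure_operator_iff)
  \<comment> \<open>A bound by a fixed point \<open>u\<close> survives replacing \<open>x\<close>
    with \<open>f x\<close>: move \<open>a\<close> across the adjunction, apply \<open>f\<close>,
    and move it back.\<close>
  have extend: "a \<sqinter> f x \<sqsubseteq> u"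
    if "a \<in> carrier L" "x \<in> carrier L" "u \<in> carrier L" "f u = u" "a \<sqinter> x \<sqsubseteq> u" for a x u
  proof -
    have "x \<sqsubseteq> heyting_imp a u"
      using that by (simp add: le_heyting_imp_iff)
    then have "f x \<sqsubseteq> f (heyting_imp a u)"
      using f that heyting_imp_closed by (simp add: closure_operator_iff)
    then show ?thesis
      using that heyting_imp_fixed fc by (simp add: le_heyting_imp_iff)
  qed
  fix x y assume xy: "x \<in> carrier L" "y \<in> carrier L"
  \<comment> \<open>\<open>extend\<close> is used twice with the fixed point
    \<open>u = f (x \<sqinter> y)\<close>. It acts on the right argument of the meet, hence the swap
    in between.\<close>
  then have "x \<sqinter> f y \<sqsubseteq> f (x \<sqinter> y)"
    using fc by (intro extend) auto
  then have "f y \<sqinter> x \<sqsubseteq> f (x \<sqinter> y)"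
    by (simp add: meet_comm)
  then have "f y \<sqinter> f x \<sqsubseteq> f (x \<sqinter> y)"
    using xy fc by (intro extend) auto
  then show "f x \<sqinter> f y \<sqsubseteq> f (x \<sqinter> y)"
    by (simp add: meet_comm)
qed

section \<open>Joins of nuclei\<close>

lemma nucleus_sup_Cl:
  assumes G: "G \<subseteq> carrier (Nuc L)"
  shows "nucleus L (\<Squnion>\<^bsub>Cl L\<^esub>G)"
proof (rule nucleus_if_heyting_imp_fixed)
  interpret C: complete_lattice "Cl L"
    by (rule complete_lattice_Cl)
  have GC: "G \<subseteq> carrier (Cl L)"
    using G by (auto simp: Cl_def Nuc_def nucleus_iff)
  then show "closure_operator L (\<Squnion>\<^bsub>Cl L\<^esub>G)"
    using C.sup_closed by (auto simp: Cl_def)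
  show "(\<Squnion>\<^bsub>Cl L\<^esub>G) (heyting_imp a u) = heyting_imp a u"
    if "a \<in> carrier L" "u \<in> carrier L" "(\<Squnion>\<^bsub>Cl L\<^esub>G) u = u" for a u
    using that G heyting_imp_closed nucleus_heyting_imp_fixed
    by (auto simp: sup_Cl_fixed_iff[OF GC] Nuc_def)
qed

text \<open>The join in \<open>Cl L\<close> is itself a nucleus, and being least among all closure
  operators above \<open>G\<close> it is least among the nuclei above \<open>G\<close>.\<close>

lemma sup_Nuc:
  assumes G: "G \<subseteq> carrier (Nuc L)"
  shows "\<Squnion>\<^bsub>Nuc L\<^esub>G = \<Squnion>\<^bsub>Cl L\<^esub>G"
proof -
  interpret C: complete_lattice "Cl L"
    by (rule complete_lattice_Cl)
  interpret N: complete_lattice "Nuc L"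
    by (rule complete_lattice_Nuc)
  have sub: "carrier (Nuc L) \<subseteq> carrier (Cl L)"
    by (auto simp: Cl_def Nuc_def nucleus_iff)
  have le: "f \<sqsubseteq>\<^bsub>Nuc L\<^esub> g \<longleftrightarrow> f \<sqsubseteq>\<^bsub>Cl L\<^esub> g" for f g
    by (simp add: Cl_def Nuc_def)
  have GC: "G \<subseteq> carrier (Cl L)"
    using G sub by blast
  have closed: "\<Squnion>\<^bsub>Cl L\<^esub>G \<in> carrier (Nuc L)"
    using nucleus_sup_Cl[OF G] by (simp add: Nuc_def)
  show ?thesis
  proof (rule N.le_antisym)
    show "\<Squnion>\<^bsub>Nuc L\<^esub>G \<sqsubseteq>\<^bsub>Nuc L\<^esub> \<Squnion>\<^bsub>Cl L\<^esub>G"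
      using G closed C.sup_upper[OF GC] by (intro N.sup_least) (auto simp: le)
    show "\<Squnion>\<^bsub>Cl L\<^esub>G \<sqsubseteq>\<^bsub>Nuc L\<^esub> \<Squnion>\<^bsub>Nuc L\<^esub>G"
      unfolding le using N.sup_closed[OF G] N.sup_upper[OF G] sub GC
      by (intro C.sup_least) (auto simp: le)
  qed (use closed N.sup_closed[OF G] in auto)
qed

end

theorem proposition6p2:
  fixes L :: "('a, 'b) gorder_scheme"
  assumes "frame L"
  shows "complete_lattice (Cl L) \<and> complete_lattice (Nuc L) \<and>
    (\<forall>G \<subseteq> carrier (Cl L). \<Sqinter>\<^bsub>Cl L\<^esub>G = pointwise_meet L G) \<and>
    (\<forall>G \<subseteq> carrier (Nuc L). \<Sqinter>\<^bsub>Nuc L\<^esub>G = pointwise_meet L G \<and> \<Sqinter>\<^bsub>Nuc L\<^esub>G = \<Sqinter>\<^bsub>Cl L\<^esub>G) \<and>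
    (\<forall>G \<subseteq> carrier (Nuc L). \<Squnion>\<^bsub>Nuc L\<^esub>G = \<Squnion>\<^bsub>Cl L\<^esub>G) \<and>
    sub_complete_lattice (carrier (Nuc L)) (Cl L)"
proof -
  interpret frame L
    by fact
  interpret N: complete_lattice "Nuc L"
    by (rule complete_lattice_Nuc)
  have sub: "carrier (Nuc L) \<subseteq> carrier (Cl L)"
    by (auto simp: Cl_def Nuc_def nucleus_iff)
  have inf: "\<Sqinter>\<^bsub>Nuc L\<^esub>G = \<Sqinter>\<^bsub>Cl L\<^esub>G" if "G \<subseteq> carrier (Nuc L)" for G
    using that sub by (simp add: inf_Nuc inf_Cl)
  have "sub_complete_lattice (carrier (Nuc L)) (Cl L)"
    unfolding sub_complete_lattice_def
    \<comment> \<open>Rewriting joins and meets of \<open>Cl L\<close> into those of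
      \<open>Nuc L\<close> reduces closure to the completeness of \<open>Nuc L\<close>; empty
      families are included.\<close>
    using complete_lattice_Cl sub N.sup_closed N.inf_closed by (simp flip: inf sup_Nuc)
  then show ?thesis
    using complete_lattice_Cl complete_lattice_Nuc inf_Cl inf_Nuc inf sup_Nuc by blast
qed

end
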